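(* Let $l\ge 1$, let $m_1,\dots,m_l\ge1$ be integers with $\sum_{j=1}^l m_j=d$, and let $\vec A=(A_1,\dots,A_l)$, where each $A_j:\mathbb{R}^{m_j}\to\mathbb{R}^{m_j}$ is a linear operator with $\det(A_j)\ne0$. Let $Q\subset[1,\infty]^l$ be a convex set with non-empty interior $Q^0$, let $\psi,\zeta\in\Psi(Q)$, and set $\nu(\vec p)=\psi(\vec p)\,\zeta(\vec p)$. Put $\delta_j=|\det A_j|^{-1/m_j}$ and let $$K=\prod_{j=1}^l[0,\delta_j]^{m_j}\subset\mathbb{R}^{m_1}\times\cdots\times\mathbb{R}^{m_l}=\mathbb{R}^d.$$ Then for every $f\in G\psi$, $$\|V_{\vec A}[f]\|_{G\nu}\;\le\;\phi(G\zeta,K)\,\|f\|_{G\psi}.$$ Moreover, this estimate is in general non-improvable; for example, equality is attained when $\vec A$ is diagonal (every $A_j$ is a diagonal matrix) and $\psi$ is the natural function of a factorable function $f$, i.e. $f(\vec x)=\prod_{j=1}^l g_j(x_j)$ and $\psi(\vec p)=|f|_{\vec p}<\infty$ for $\vec p\in Q^0$.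
   Context: Points of $\mathbb{R}^d=\mathbb{R}^{m_1}\times\cdots\times\mathbb{R}^{m_l}$ are written $\vec x=(x_1,\dots,x_l)$, $x_j\in\mathbb{R}^{m_j}$, each factor carrying Lebesgue measure. For $\vec p=(p_1,\dots,p_l)$, $1\le p_j\le\infty$, the mixed Lebesgue norm of a measurable $f:\mathbb{R}^d\to\mathbb{R}$ is $$|f|_{\vec p}=\left(\int_{\mathbb{R}^{m_l}}dx_l\left(\int_{\mathbb{R}^{m_{l-1}}}dx_{l-1}\cdots\left(\int_{\mathbb{R}^{m_1}}|f(\vec x)|^{p_1}dx_1\right)^{p_2/p_1}\right)^{p_3/p_2}\cdots\right)^{1/p_l},$$ i.e. one takes successively the $L_{p_1}$ norm in $x_1$, then the $L_{p_2}$ norm in $x_2$, and so on. For a convex (bounded or not) set $Q\subset[1,\infty]^l$ with interior $Q^0$, $\Psi(Q)$ is the set of strictly positive functions $\psi=\psi(\vec p)$ continuous on $Q^0$ with $\inf_{\vec p\in Q^0}\psi(\vec p)>0$ (and, by convention, $\psi=\infty$ outside $Q^0$). For $\psi\in\Psi(Q)$ the Anisotropic Grand Lebesgue Space, denoted $G\psi$, consists of all measurable $f:\mathbb{R}^d\to\mathbb{R}$ with finite norm $$\|f\|_{G\psi}=\sup_{\vec p\in Q^0}\frac{|f|_{\vec p}}{\psi(\vec p)}.$$ The fundamental function of $G\zeta$ evaluated at a measurable set $D\subset\mathbb{R}^d$ is $\phi(G\zeta,D)=\|I_D\|_{G\zeta}$, where $I_D$ is the indicator function of $D$. The tensor dilation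 operator is $V_{\vec A}[f](\vec x)=f(A_1x_1,\dots,A_lx_l)$. *)

theory Defs
  imports
    "HOL-Analysis.Analysis"
    "HOL-Probability.Essential_Supremum"
    "Jordan_Normal_Form.Determinant"
begin

text \<open>
  The number \<open>l\<close> of factors and their dimensions vary, so vectors are extensional functions:
  the factors are indexed by \<open>{..<l}\<close>, a vector of the factor of dimension \<open>m j\<close> is an element of
  \<open>{..<m j} \<rightarrow>\<^sub>E UNIV\<close>, and a point of the whole space is an element of
  \<open>\<Pi>\<^sub>E j\<in>{..<l}. {..<m j} \<rightarrow>\<^sub>E UNIV\<close>.
  Both measures below are completed, so that measurability is measurability in the sense of
  Lebesgue.
\<close>

definition leb_factor :: "nat \<Rightarrow> (nat \<Rightarrow> real) measure" where
  "leb_factor n = completion (PiM {..<n} (\<lambda>_. lborel))"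

definition leb_prod :: "nat \<Rightarrow> (nat \<Rightarrow> nat) \<Rightarrow> (nat \<Rightarrow> nat \<Rightarrow> real) measure" where
  "leb_prod l m = completion (PiM {..<l} (\<lambda>j. PiM {..<m j} (\<lambda>_. lborel)))"

text \<open>Powers with a positive real exponent, so that \<open>\<infinity> \<mapsto> \<infinity>\<close>.\<close>

definition epowr :: "ennreal \<Rightarrow> real \<Rightarrow> ennreal" where
  "epowr t a = (if t = \<infinity> then \<infinity> else ennreal (enn2real t powr a))"

definition Lp_norm :: "'a measure \<Rightarrow> ennreal \<Rightarrow> ('a \<Rightarrow> ennreal) \<Rightarrow> ennreal" where
  "Lp_norm M p g =
     (if p = \<infinity> then esssup M g
      else epowr (\<integral>\<^sup>+y. epowr (g y) (enn2real p) \<partial>M) (1 / enn2real p))"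

text \<open>
  \<open>iter_norm m p F k x\<close> takes the norms in the variables \<open>0, \<dots>, k - 1\<close>, innermost first; the result
  depends only on the values of \<open>x\<close> at the indices from \<open>k\<close> on. In \<open>mixed_norm\<close> all variables are
  integrated out, and the starting point \<open>\<lambda>_. undefined\<close> makes the points at which
  \<open>f\<close> is evaluated extensional.
\<close>

primrec iter_norm ::
  "(nat \<Rightarrow> nat) \<Rightarrow> (nat \<Rightarrow> ennreal) \<Rightarrow> ((nat \<Rightarrow> nat \<Rightarrow> real) \<Rightarrow> ennreal) \<Rightarrow> nat
     \<Rightarrow> (nat \<Rightarrow> nat \<Rightarrow> real) \<Rightarrow> ennreal" where
  "iter_norm m p F 0 x = F x"
| "iter_norm m p F (Suc k) x =
     Lp_norm (leb_factor (m k)) (p k) (\<lambda>y. iter_norm m p F k (x(k := y)))"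

definition mixed_norm ::
  "nat \<Rightarrow> (nat \<Rightarrow> nat) \<Rightarrow> (nat \<Rightarrow> ennreal) \<Rightarrow> ((nat \<Rightarrow> nat \<Rightarrow> real) \<Rightarrow> real) \<Rightarrow> ennreal" where
  "mixed_norm l m p f = iter_norm m p (\<lambda>x. ennreal \<bar>f x\<bar>) l (\<lambda>_. undefined)"

text \<open>
  The exponents range over the topological space \<open>[1,\<infinity>]\<^sup>l\<close>, and \<open>exp_interior\<close> is the interior in
  that space. The interior in \<open>\<real>\<^sup>l\<close> of a convex set of exponents is convex and open
  in \<open>[1,\<infinity>]\<^sup>l\<close>, hence equal to its own \<open>exp_interior\<close>; so statements about all convex \<open>Q\<close> with
  the present interior include those with the interior taken in \<open>\<real>\<^sup>l\<close>.
\<close>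

definition exp_space :: "nat \<Rightarrow> (nat \<Rightarrow> ennreal) topology" where
  "exp_space l = product_topology (\<lambda>_. top_of_set {1..}) {..<l}"

definition exp_interior :: "nat \<Rightarrow> (nat \<Rightarrow> ennreal) set \<Rightarrow> (nat \<Rightarrow> ennreal) set" where
  "exp_interior l Q = (exp_space l) interior_of Q"

definition exp_convex :: "nat \<Rightarrow> (nat \<Rightarrow> ennreal) set \<Rightarrow> bool" where
  "exp_convex l Q \<longleftrightarrow>
     (\<forall>p\<in>Q. \<forall>q\<in>Q. \<forall>u v. u + v = 1 \<longrightarrow> (\<lambda>j\<in>{..<l}. u * p j + v * q j) \<in> Q)"

definition Psi :: "nat \<Rightarrow> (nat \<Rightarrow> ennreal) set \<Rightarrow> ((nat \<Rightarrow> ennreal) \<Rightarrow> ennreal) set" where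
  "Psi l Q = {\<psi>.
     (\<forall>p\<in>exp_interior l Q. 0 < \<psi> p \<and> \<psi> p < \<infinity>) \<and>
     continuous_map (subtopology (exp_space l) (exp_interior l Q)) euclidean \<psi> \<and>
     0 < (INF p\<in>exp_interior l Q. \<psi> p) \<and>
     (\<forall>p. p \<notin> exp_interior l Q \<longrightarrow> \<psi> p = \<infinity>)}"

definition GLS_norm ::
  "nat \<Rightarrow> (nat \<Rightarrow> nat) \<Rightarrow> (nat \<Rightarrow> ennreal) set \<Rightarrow> ((nat \<Rightarrow> ennreal) \<Rightarrow> ennreal)
     \<Rightarrow> ((nat \<Rightarrow> nat \<Rightarrow> real) \<Rightarrow> real) \<Rightarrow> ennreal" where
  "GLS_norm l m Q \<psi> f = (SUP p\<in>exp_interior l Q. mixed_norm l m p f / \<psi> p)"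

definition GLS ::
  "nat \<Rightarrow> (nat \<Rightarrow> nat) \<Rightarrow> (nat \<Rightarrow> ennreal) set \<Rightarrow> ((nat \<Rightarrow> ennreal) \<Rightarrow> ennreal)
     \<Rightarrow> ((nat \<Rightarrow> nat \<Rightarrow> real) \<Rightarrow> real) set" where
  "GLS l m Q \<psi> = {f. f \<in> borel_measurable (leb_prod l m) \<and> GLS_norm l m Q \<psi> f < \<infinity>}"

definition fundamental ::
  "nat \<Rightarrow> (nat \<Rightarrow> nat) \<Rightarrow> (nat \<Rightarrow> ennreal) set \<Rightarrow> ((nat \<Rightarrow> ennreal) \<Rightarrow> ennreal)
     \<Rightarrow> (nat \<Rightarrow> nat \<Rightarrow> real) set \<Rightarrow> ennreal" where
  "fundamental l m Q \<zeta> D = GLS_norm l m Q \<zeta> (indicator D)"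

definition mat_apply :: "real mat \<Rightarrow> (nat \<Rightarrow> real) \<Rightarrow> nat \<Rightarrow> real" where
  "mat_apply A x = (\<lambda>i\<in>{..<dim_row A}. Matrix.vec_index (A *\<^sub>v Matrix.vec (dim_col A) x) i)"

definition dilation ::
  "nat \<Rightarrow> (nat \<Rightarrow> real mat) \<Rightarrow> ((nat \<Rightarrow> nat \<Rightarrow> real) \<Rightarrow> real)
     \<Rightarrow> (nat \<Rightarrow> nat \<Rightarrow> real) \<Rightarrow> real" where
  "dilation l A f x = f (\<lambda>j\<in>{..<l}. mat_apply (A j) (x j))"

definition dil_side :: "(nat \<Rightarrow> nat) \<Rightarrow> (nat \<Rightarrow> real mat) \<Rightarrow> nat \<Rightarrow> real" where
  "dil_side m A j = \<bar>Determinant.det (A j)\<bar> powr (- 1 / real (m j))"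

definition dil_box ::
  "nat \<Rightarrow> (nat \<Rightarrow> nat) \<Rightarrow> (nat \<Rightarrow> real mat) \<Rightarrow> (nat \<Rightarrow> nat \<Rightarrow> real) set" where
  "dil_box l m A = (\<Pi>\<^sub>E j\<in>{..<l}. \<Pi>\<^sub>E i\<in>{..<m j}. {0..dil_side m A j})"

definition factorable ::
  "nat \<Rightarrow> (nat \<Rightarrow> nat) \<Rightarrow> ((nat \<Rightarrow> nat \<Rightarrow> real) \<Rightarrow> real) \<Rightarrow> bool" where
  "factorable l m f \<longleftrightarrow>
     (\<exists>g :: nat \<Rightarrow> (nat \<Rightarrow> real) \<Rightarrow> real.
        \<forall>x\<in>(\<Pi>\<^sub>E j\<in>{..<l}. {..<m j} \<rightarrow>\<^sub>E UNIV). f x = (\<Prod>j<l. g j (x j)))"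

end

theory Submission
  imports Defs
begin

text \<open>
  A linear change of variables in each factor shows that
  \<open>|V\<^sub>A f|\<^sub>p = (\<Prod>j. |det A\<^sub>j| powr (- 1 / p\<^sub>j)) |f|\<^sub>p\<close> for every function \<open>f\<close>, and the product on the right is
  also \<open>|I\<^sub>K|\<^sub>p\<close>. Dividing by \<open>\<nu> = \<psi> \<zeta>\<close>, the estimate says that the supremum of a product is at most the
  product of the suprema. If \<open>\<psi>\<close> is the natural function of \<open>f\<close>, then one factor is constantly \<open>1\<close> and
  equality holds; the indicator of the unit cube, whose mixed norms are all \<open>1\<close>, shows that the
  constant is optimal for every \<open>\<zeta>\<close>. Iterated norms need not be measurable in the remaining variables, so
  the change of variables is proved for arbitrary functions.
\<close>

section \<open>Invertible matrices as products of row replacements\<close>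

text \<open>The identity matrix with row \<open>k\<close> replaced by \<open>r\<close>. This single
  family covers both scalings and shears, and on vectors it changes only coordinate
  \<open>k\<close>, so integrals over it reduce to one dimension.\<close>

definition row_repl :: "nat \<Rightarrow> nat \<Rightarrow> (nat \<Rightarrow> real) \<Rightarrow> real mat" where
  "row_repl n k r = Matrix.mat n n (\<lambda>(i, j). if i = k then r j else if i = j then 1 else 0)"

lemma row_repl_carrier [simp]: "row_repl n k r \<in> carrier_mat n n"
  by (simp add: row_repl_def)

lemma index_mult_row_repl:
  assumes "B \<in> carrier_mat n n" "k < n" "i < n" "j < n"
  shows "(B * row_repl n k r) $$ (i, j) = B $$ (i, k) * r j + (if j = k then 0 else B $$ (i, j))"
proof -
  have "(B * row_repl n k r) $$ (i, j) =
      (\<Sum>t<n. B $$ (i, t) * (if t = k then r j else if t = j then 1 else 0))"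
    using assms by (auto simp: row_repl_def scalar_prod_def lessThan_atLeast0 intro!: sum.cong)
  also have "\<dots> = B $$ (i, k) * r j
      + (\<Sum>t\<in>{..<n} - {k}. B $$ (i, t) * (if t = j then 1 else 0))"
    using assms(2) by (simp add: sum.remove[where x = k])
  also have "(\<Sum>t\<in>{..<n} - {k}. B $$ (i, t) * (if t = j then 1 else 0))
      = (if j = k then 0 else B $$ (i, j))"
    using assms(4) by (simp add: if_distrib[of "\<lambda>x. _ * x"] cong: if_cong)
  finally show ?thesis .
qed

text \<open>Only the identity permutation contributes to the Leibniz sum. A permutation fixing every
  index other than \<open>k\<close> also fixes \<open>k\<close>; hence any other one moves some
  \<open>i \<noteq> k\<close>, and row \<open>i\<close> is a row of the identity matrix with a zero
  at that place.\<close>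

lemma det_row_repl:
  assumes "k < n"
  shows "Determinant.det (row_repl n k r) = r k"
proof -
  let ?R = "row_repl n k r"
  let ?s = "\<lambda>p. signof p * (\<Prod>i = 0..<n. ?R $$ (i, p i)) :: real"
  have zero: "?s p = 0" if p: "p permutes {0..<n}" "p \<noteq> id" for p
  proof -
    have "\<exists>i. i < n \<and> i \<noteq> k \<and> p i \<noteq> i"
    proof (rule ccontr)
      assume "\<not> ?thesis"
      then have fix': "p i = i" if "i \<noteq> k" for i
        using that permutes_not_in[OF p(1), of i] by (cases "i < n") auto
      then have "p k = k"
        using permutes_inj[OF p(1)] by (metis injD)
      with fix' have "p = id" by (metis eq_id_iff)
      with p(2) show False ..
    qed
    then obtain i where i: "i < n" "i \<noteq> k" "p i \<noteq> i" by blast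
    moreover have "p i < n"
      using permutes_in_image[OF p(1), of i] i(1) by simp
    ultimately have "?R $$ (i, p i) = 0"
      by (simp add: row_repl_def)
    with i(1) have "(\<Prod>i = 0..<n. ?R $$ (i, p i)) = 0"
      by (intro prod_zero) auto
    then show ?thesis by simp
  qed
  have "Determinant.det ?R = (\<Sum>p | p permutes {0..<n}. ?s p)"
    by (rule det_def') simp
  also have "\<dots> = (\<Sum>p\<in>{id}. ?s p)"
    by (rule sum.mono_neutral_right) (auto simp: zero permutes_id finite_permutations simp del: mult_eq_0_iff)
  also have "\<dots> = (\<Prod>i = 0..<n. ?R $$ (i, i))"
    by (simp add: sign_id)
  also have "\<dots> = (\<Prod>i = 0..<n. if i = k then r k else 1)"
    by (rule prod.cong) (auto simp: row_repl_def)
  also have "\<dots> = r k"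
    using assms by (simp add: prod.delta)
  finally show ?thesis .
qed

text \<open>The hypotheses on \<open>s\<close> and \<open>r\<close> say that
  \<open>row_repl n k s * row_repl n k r\<close> is the identity matrix.\<close>

lemma row_repl_cancel:
  assumes A: "A \<in> carrier_mat n n" and "k < n"
    and "s k * r k = 1" "\<And>j. j < n \<Longrightarrow> j \<noteq> k \<Longrightarrow> s k * r j + s j = 0"
  shows "A = A * row_repl n k s * row_repl n k r"
proof (rule eq_matI)
  have A': "A * row_repl n k s \<in> carrier_mat n n" using A by simp
  fix i j assume "i < dim_row (A * row_repl n k s * row_repl n k r)"
    "j < dim_col (A * row_repl n k s * row_repl n k r)"
  then have ij: "i < n" "j < n" using A by (simp_all add: row_repl_def)
  have "A $$ (i, k) * (s k * r j) + (if j = k then 0 else A $$ (i, k) * s j) + (if j = k then 0 else A $$ (i, j))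
      = A $$ (i, j)"
  proof (cases "j = k")
    case False
    then have "A $$ (i, k) * (s k * r j + s j) = 0" using assms(4) ij by simp
    with False show ?thesis by (simp add: algebra_simps)
  qed (simp add: assms(3))
  then show "A $$ (i, j) = (A * row_repl n k s * row_repl n k r) $$ (i, j)"
    using ij \<open>k < n\<close> by (simp add: index_mult_row_repl[OF A'] index_mult_row_repl[OF A] algebra_simps split: if_splits)
qed (use A in \<open>simp_all add: row_repl_def\<close>)

text \<open>Column elimination from the right; a zero pivot is repaired by adding a later column.\<close>

lemma invertible_mat_row_repl_induct [consumes 2, case_names one mult]:
  fixes A :: "real mat"
  assumes "A \<in> carrier_mat n n" "Determinant.det A \<noteq> 0"
    and one: "P (1\<^sub>m n)"
    and mult: "\<And>B k r. B \<in> carrier_mat n n \<Longrightarrow> Determinant.det B \<noteq> 0 \<Longrightarrow> P B \<Longrightarrow> k < n \<Longrightarrow> r k \<noteq> 0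
      \<Longrightarrow> P (B * row_repl n k r)"
  shows "P A"
proof -
  \<comment> \<open>Generalised for an induction downwards from \<open>k = n\<close>: the invariant
    is that the first \<open>k\<close> rows are already those of the identity matrix.\<close>
  have "P A" if "k \<le> n" "A \<in> carrier_mat n n" "Determinant.det A \<noteq> 0"
    "\<And>i j. i < k \<Longrightarrow> j < n \<Longrightarrow> A $$ (i, j) = (if i = j then 1 else 0)" for k A
    using that
  proof (induction k arbitrary: A rule: inc_induct)
    case base
    then have "A = 1\<^sub>m n" by (intro eq_matI) auto
    with one show ?case by simp
  next
    case (step k)
    have pivot: "P B" if B: "B \<in> carrier_mat n n" "Determinant.det B \<noteq> 0" "B $$ (k, k) \<noteq> 0"
      "\<And>i j. i < k \<Longrightarrow> j < n \<Longrightarrow> B $$ (i, j) = (if i = j then 1 else 0)" for B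
    proof -
      \<comment> \<open>\<open>r\<close> is the pivot row and \<open>s\<close> the row inverse to
        it. Multiplication by \<open>row_repl n k s\<close> divides column \<open>k\<close> by the
        pivot and clears the rest of row \<open>k\<close>; the rows above are kept because their
        entries in column \<open>k\<close> vanish.\<close>
      define r where "r j = B $$ (k, j)" for j
      define s where "s j = (if j = k then 1 / r k else - r j / r k)" for j
      let ?B = "B * row_repl n k s"
      have rk: "r k \<noteq> 0" using B by (simp add: r_def)
      have C: "?B \<in> carrier_mat n n" using B by simp
      have D: "Determinant.det ?B \<noteq> 0"
        using B rk step.hyps by (simp add: det_mult[of _ n] det_row_repl) (simp add: s_def)
      have "P ?B"
      proof (rule step.IH[OF C D])
        fix i j assume ij: "i < Suc k" "j < n"
        then show "?B $$ (i, j) = (if i = j then 1 else 0)"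
          using step.hyps B(1) B(4)[of i j] B(4)[of i k] rk
          by (cases "i = k") (auto simp: index_mult_row_repl s_def r_def field_simps)
      qed
      then have "P (?B * row_repl n k r)"
        using mult C D rk step.hyps by blast
      moreover have "B = ?B * row_repl n k r"
        using B(1) step.hyps rk by (intro row_repl_cancel) (auto simp: s_def)
      ultimately show ?thesis by simp
    qed
    show ?case
    proof (cases "A $$ (k, k) = 0")
      case False
      with step pivot show ?thesis by blast
    next
      case True
      \<comment> \<open>If row \<open>k\<close> vanished from the diagonal on, it would be a linear
        combination of the unit rows above it; the coefficients of this relation form the vector
        \<open>v\<close> in the kernel of the transpose.\<close>
      obtain t where t: "k \<le> t" "t < n" "A $$ (k, t) \<noteq> 0"
      proof (rule ccontr)
        assume "\<not> thesis"
        with that have z: "A $$ (k, t) = 0" if "k \<le> t" "t < n" for t using that by blast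
        define v where "v = Matrix.vec n (\<lambda>i. if i = k then 1 else if i < k then - A $$ (k, i) else 0)"
        have "transpose_mat A *\<^sub>v v = 0\<^sub>v n"
        proof (rule eq_vecI)
          fix j assume "j < dim_vec (0\<^sub>v n)"
          then have j: "j < n" by simp
          have "(transpose_mat A *\<^sub>v v) $ j
              = (\<Sum>i<n. A $$ (i, j) * (if i = k then 1 else if i < k then - A $$ (k, i) else 0))"
            using j step.prems by (auto simp: v_def scalar_prod_def lessThan_atLeast0 intro!: sum.cong)
          also have "\<dots> = (\<Sum>i<n. (if i = k then A $$ (k, j) else 0) + (if i = j then if j < k then - A $$ (k, j) else 0 else 0))"
            using j step.prems(3) by (intro sum.cong) auto
          also have "\<dots> = 0"
            using j step.hyps z by (simp add: sum.distrib)
          finally show "(transpose_mat A *\<^sub>v v) $ j = 0\<^sub>v n $ j" using j by simp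
        qed (use step.prems in simp)
        moreover have "v $ k = 1" using step.hyps by (simp add: v_def)
        then have "v \<noteq> 0\<^sub>v n" using step.hyps by auto
        moreover have "v \<in> carrier_vec n" by (simp add: v_def)
        ultimately have "Determinant.det (transpose_mat A) = 0"
          using step.prems by (subst det_0_iff_vec_prod_zero[of _ n]) auto
        with step.prems show False by (simp add: det_transpose)
      qed
      with True have tk: "k < t" by (cases "k = t") auto
      \<comment> \<open>\<open>s\<close> adds column \<open>t\<close> to column \<open>k\<close>, so
        the pivot becomes \<open>A $$ (k, t)\<close>, while the rows above have a zero in column
        \<open>t\<close>. \<open>r\<close> subtracts the column again.\<close>
      define s where "s j = (if j = t \<or> j = k then 1 else 0 :: real)" for j
      define r where "r j = (if j = t then 1 else if j = k then -1 else 0 :: real)" for j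
      let ?B = "A * row_repl n t s"
      have C: "?B \<in> carrier_mat n n" using step.prems by simp
      have D: "Determinant.det ?B \<noteq> 0"
        using step.prems t by (simp add: det_mult[of _ n] det_row_repl) (simp add: s_def)
      have "P ?B"
        using tk t True step.prems step.hyps 
        by (intro pivot C D) (auto simp: index_mult_row_repl s_def)
      moreover have "r t \<noteq> 0" by (simp add: r_def)
      ultimately have "P (?B * row_repl n t r)"
        using mult C D t by blast
      moreover have "A = ?B * row_repl n t r"
        using step.prems t tk by (intro row_repl_cancel) (auto simp: s_def r_def)
      ultimately show ?thesis by simp
    qed
  qed
  from this[of 0] assms show ?thesis by auto
qed

section \<open>Linear change of variables\<close>

abbreviation lborel_fun :: "nat \<Rightarrow> (nat \<Rightarrow> real) measure" where
  "lborel_fun n \<equiv> PiM {..<n} (\<lambda>_. lborel)"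

lemma mat_apply_eq:
  assumes "A \<in> carrier_mat n n"
  shows "mat_apply A x = (\<lambda>i\<in>{..<n}. \<Sum>j<n. A $$ (i, j) * x j)"
  using assms by (auto simp: mat_apply_def scalar_prod_def lessThan_atLeast0 fun_eq_iff restrict_def)

lemma mat_apply_one: "mat_apply (1\<^sub>m n) x = restrict x {..<n}"
  by (auto simp: mat_apply_def fun_eq_iff)

lemma mat_apply_mult:
  assumes "A \<in> carrier_mat n n" "B \<in> carrier_mat n n"
  shows "mat_apply (A * B) x = mat_apply A (mat_apply B x)"
proof -
  have "Matrix.vec n (mat_apply B x) = B *\<^sub>v Matrix.vec n x"
    using assms by (intro eq_vecI) (auto simp: mat_apply_def)
  then show ?thesis
    using assms by (simp add: mat_apply_def fun_eq_iff assoc_mult_mat_vec[of _ n n _ n])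
qed

lemma measurable_mat_apply:
  assumes "A \<in> carrier_mat n n"
  shows "mat_apply A \<in> lborel_fun n \<rightarrow>\<^sub>M lborel_fun n"
  unfolding mat_apply_eq[OF assms] by measurable

lemma mat_apply_row_repl:
  assumes "k < n" "x \<in> {..<n} \<rightarrow>\<^sub>E UNIV"
  shows "mat_apply (row_repl n k r) x = x(k := \<Sum>j<n. r j * x j)"
proof
  fix i
  have "(\<Sum>j<n. row_repl n k r $$ (i, j) * x j) = (x(k := \<Sum>j<n. r j * x j)) i" if "i < n"
  proof (cases "i = k")
    case False
    then have "(\<Sum>j<n. row_repl n k r $$ (i, j) * x j) = (\<Sum>j<n. if j = i then x j else 0)"
      using that by (intro sum.cong) (auto simp: row_repl_def)
    then show ?thesis using False that by simp
  qed (use that in \<open>auto simp: row_repl_def\<close>)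
  moreover have "x i = undefined" if "\<not> i < n"
    using PiE_arb[OF assms(2)] that by simp
  ultimately show "mat_apply (row_repl n k r) x i = (x(k := \<Sum>j<n. r j * x j)) i"
    using assms(1) by (cases "i < n") (simp_all add: mat_apply_eq[OF row_repl_carrier] del: fun_upd_apply, simp)
qed

text \<open>Fubini isolates coordinate \<open>k\<close>. With the other coordinates fixed, the map
  is the affine substitution \<open>y \<mapsto> c + r k * y\<close> in one real variable, where
  \<open>c\<close> collects the fixed coordinates.\<close>

lemma nn_integral_mat_apply_row_repl:
  assumes k: "k < n" and r: "r k \<noteq> 0" and F [measurable]: "F \<in> borel_measurable (lborel_fun n)"
  shows "(\<integral>\<^sup>+x. F (mat_apply (row_repl n k r) x) \<partial>lborel_fun n)
    = ennreal (1 / \<bar>r k\<bar>) * (\<integral>\<^sup>+x. F x \<partial>lborel_fun n)"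
proof -
  interpret product_sigma_finite "\<lambda>_::nat. lborel :: real measure" ..
  let ?I = "{..<n} - {k}"
  let ?R = "row_repl n k r"
  have ins: "insert k ?I = {..<n}" using k by auto
  have [measurable]: "mat_apply ?R \<in> lborel_fun n \<rightarrow>\<^sub>M lborel_fun n"
    by (rule measurable_mat_apply) simp
  have split: "(\<integral>\<^sup>+x. G x \<partial>lborel_fun n) = (\<integral>\<^sup>+x. (\<integral>\<^sup>+y. G (x(k := y)) \<partial>lborel) \<partial>PiM ?I (\<lambda>_. lborel))"
    if "G \<in> borel_measurable (lborel_fun n)" for G :: "_ \<Rightarrow> ennreal"
    using product_nn_integral_insert[of ?I k G, unfolded ins] that by blast
  have upd: "(\<lambda>y. x(k := y)) \<in> lborel \<rightarrow>\<^sub>M lborel_fun n" if "x \<in> space (PiM ?I (\<lambda>_. lborel))" for x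
    using measurable_fun_upd[of "{..<n}" ?I k "\<lambda>_. x" lborel "\<lambda>_. lborel" "\<lambda>y. y"] that ins by auto
  have "(\<integral>\<^sup>+y. F (mat_apply ?R (x(k := y))) \<partial>lborel) = ennreal (1 / \<bar>r k\<bar>) * (\<integral>\<^sup>+y. F (x(k := y)) \<partial>lborel)"
    if x: "x \<in> space (PiM ?I (\<lambda>_. lborel))" for x
  proof -
    note upd[OF x, measurable]
    have [measurable]: "(\<lambda>y. F (x(k := y))) \<in> borel_measurable borel" by measurable
    define c where "c = (\<Sum>j\<in>?I. r j * x j)"
    have "mat_apply ?R (x(k := y)) = x(k := c + r k * y)" for y
    proof -
      have "x(k := y) \<in> {..<n} \<rightarrow>\<^sub>E UNIV"
        using x k by (auto simp: space_PiM PiE_def extensional_def)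
      moreover have "(\<Sum>j<n. r j * (x(k := y)) j) = c + r k * y"
        using k by (simp add: sum.remove[of _ k] c_def)
      ultimately show ?thesis using k by (simp add: mat_apply_row_repl)
    qed
    then have "(\<integral>\<^sup>+y. F (x(k := y)) \<partial>lborel) = \<bar>r k\<bar> * (\<integral>\<^sup>+y. F (mat_apply ?R (x(k := y))) \<partial>lborel)"
      using r nn_integral_real_affine[of "\<lambda>y. F (x(k := y))" "r k" c] by simp
    then show ?thesis
      using r by (simp add: mult.assoc[symmetric] ennreal_mult'[symmetric])
  qed
  note inner = this
  have "(\<integral>\<^sup>+x. F (mat_apply ?R x) \<partial>lborel_fun n)
      = (\<integral>\<^sup>+x. ennreal (1 / \<bar>r k\<bar>) * (\<integral>\<^sup>+y. F (x(k := y)) \<partial>lborel) \<partial>PiM ?I (\<lambda>_. lborel))"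
    by (subst split, measurable, rule nn_integral_cong, rule inner)
  also have "\<dots> = ennreal (1 / \<bar>r k\<bar>) * (\<integral>\<^sup>+x. (\<integral>\<^sup>+y. F (x(k := y)) \<partial>lborel) \<partial>PiM ?I (\<lambda>_. lborel))"
  proof (rule nn_integral_cmult)
    \<comment> \<open>Joint measurability makes the inner integral measurable in \<open>x\<close>,
      which is what allows the constant to be pulled out.\<close>
    have "(\<lambda>(x, y). F (x(k := y))) \<in> borel_measurable (PiM ?I (\<lambda>_. lborel) \<Otimes>\<^sub>M lborel)"
      using measurable_compose[OF measurable_add_dim[of k ?I "\<lambda>_. lborel", unfolded ins] F]
      unfolding split_beta' .
    then show "(\<lambda>x. \<integral>\<^sup>+y. F (x(k := y)) \<partial>lborel) \<in> borel_measurable (PiM ?I (\<lambda>_. lborel))"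
      by (rule lborel.borel_measurable_nn_integral)
  qed
  also have "\<dots> = ennreal (1 / \<bar>r k\<bar>) * (\<integral>\<^sup>+x. F x \<partial>lborel_fun n)"
    by (simp only: split[OF F])
  finally show ?thesis .
qed

text \<open>In a product \<open>B * row_repl n k r\<close> the row replacement acts first: its
  formula is applied to \<open>F\<close> composed with \<open>B\<close>, then the induction
  hypothesis to \<open>F\<close>, and the determinants multiply.\<close>

lemma nn_integral_mat_apply_measurable:
  assumes "A \<in> carrier_mat n n" "Determinant.det A \<noteq> 0" "F \<in> borel_measurable (lborel_fun n)"
  shows "(\<integral>\<^sup>+x. F (mat_apply A x) \<partial>lborel_fun n)
    = ennreal (1 / \<bar>Determinant.det A\<bar>) * (\<integral>\<^sup>+x. F x \<partial>lborel_fun n)"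
  using assms
proof (induction A arbitrary: F rule: invertible_mat_row_repl_induct)
  case one
  have "(\<integral>\<^sup>+x. F (mat_apply (1\<^sub>m n) x) \<partial>lborel_fun n) = (\<integral>\<^sup>+x. F x \<partial>lborel_fun n)"
    by (rule nn_integral_cong) (auto simp: mat_apply_one space_PiM PiE_def extensional_restrict)
  then show ?case by simp
next
  case (mult B k r)
  have "(\<lambda>x. F (mat_apply B x)) \<in> borel_measurable (lborel_fun n)"
    using measurable_compose[OF measurable_mat_apply[OF mult.hyps(1)] mult.prems] .
  then have "(\<integral>\<^sup>+x. F (mat_apply (B * row_repl n k r) x) \<partial>lborel_fun n)
      = ennreal (1 / \<bar>r k\<bar>) * (ennreal (1 / \<bar>Determinant.det B\<bar>) * (\<integral>\<^sup>+x. F x \<partial>lborel_fun n))"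
    using mult nn_integral_mat_apply_row_repl[where F = "\<lambda>x. F (mat_apply B x)"]
    by (simp add: mat_apply_mult[of _ n])
  also have "\<dots> = ennreal (1 / \<bar>r k\<bar> * (1 / \<bar>Determinant.det B\<bar>)) * (\<integral>\<^sup>+x. F x \<partial>lborel_fun n)"
    by (simp add: mult.assoc[symmetric] ennreal_mult'[symmetric])
  also have "1 / \<bar>r k\<bar> * (1 / \<bar>Determinant.det B\<bar>) = 1 / \<bar>Determinant.det (B * row_repl n k r)\<bar>"
    using mult.hyps by (simp add: det_mult[of _ n] det_row_repl abs_mult)
  finally show ?case .
qed

section \<open>Norms and changes of variables for arbitrary functions\<close>

text \<open>No measurability of \<open>g\<close>: the integral of a non-measurable function is a lower integral, and the
  claim passes to the supremum over the simple functions below \<open>g\<close>.\<close>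

lemma nn_integral_transform_le:
  fixes \<Phi> :: "('a \<Rightarrow> ennreal) \<Rightarrow> 'a \<Rightarrow> ennreal"
  assumes mono: "\<And>h g. h \<le> g \<Longrightarrow> \<Phi> h \<le> \<Phi> g"
    and eq: "\<And>h. h \<in> borel_measurable M \<Longrightarrow> (\<integral>\<^sup>+x. \<Phi> h x \<partial>M) = c * (\<integral>\<^sup>+x. h x \<partial>M)"
  shows "c * (\<integral>\<^sup>+x. g x \<partial>M) \<le> (\<integral>\<^sup>+x. \<Phi> g x \<partial>M)"
  unfolding nn_integral_def[of M g] SUP_mult_left_ennreal
proof (rule SUP_least, clarsimp)
  fix h assume h: "simple_function M h" "h \<le> g"
  have "c * integral\<^sup>S M h = (\<integral>\<^sup>+x. \<Phi> h x \<partial>M)"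
    using h(1) by (simp add: eq nn_integral_eq_simple_integral borel_measurable_simple_function)
  also have "\<dots> \<le> (\<integral>\<^sup>+x. \<Phi> g x \<partial>M)"
    using mono[OF h(2)] by (intro nn_integral_mono) (simp add: le_fun_def)
  finally show "c * integral\<^sup>S M h \<le> (\<integral>\<^sup>+x. \<Phi> g x \<partial>M)" .
qed

text \<open>One inequality comes from the simple functions below \<open>g\<close>; the other is the
  same inequality for the constant \<open>1 / c\<close> and the function
  \<open>c * g\<close>.\<close>

lemma nn_integral_cmult_pos_real:
  assumes "0 < c"
  shows "(\<integral>\<^sup>+x. ennreal c * g x \<partial>M) = ennreal c * (\<integral>\<^sup>+x. g x \<partial>M)"
proof (rule antisym)
  have le: "ennreal d * (\<integral>\<^sup>+x. f x \<partial>M) \<le> (\<integral>\<^sup>+x. ennreal d * f x \<partial>M)" for d f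
    by (rule nn_integral_transform_le) (auto simp: le_fun_def nn_integral_cmult intro: mult_left_mono)
  show "ennreal c * (\<integral>\<^sup>+x. g x \<partial>M) \<le> (\<integral>\<^sup>+x. ennreal c * g x \<partial>M)" by (rule le)
  have "(\<integral>\<^sup>+x. ennreal c * g x \<partial>M) = ennreal c * (ennreal (1 / c) * (\<integral>\<^sup>+x. ennreal c * g x \<partial>M))"
    using assms by (simp add: mult.assoc[symmetric] ennreal_mult'[symmetric])
  also have "\<dots> \<le> ennreal c * (\<integral>\<^sup>+x. ennreal (1 / c) * (ennreal c * g x) \<partial>M)"
    by (intro mult_left_mono le) simp
  also have "\<dots> = ennreal c * (\<integral>\<^sup>+x. g x \<partial>M)"
    using assms by (simp add: mult.assoc[symmetric] ennreal_mult'[symmetric])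
  finally show "(\<integral>\<^sup>+x. ennreal c * g x \<partial>M) \<le> ennreal c * (\<integral>\<^sup>+x. g x \<partial>M)" .
qed

text \<open>\<open>esssup\<close> is defined by a case distinction on measurability, so
  measurability has to be transferred along with the limit superior.\<close>

lemma esssup_cong:
  assumes "\<And>x. x \<in> space M \<Longrightarrow> f x = g x"
  shows "esssup M f = esssup M g"
proof -
  have "f \<in> borel_measurable M \<longleftrightarrow> g \<in> borel_measurable M"
    using assms by (rule measurable_cong)
  moreover have "Limsup (ae_filter M) f = Limsup (ae_filter M) g"
    using assms by (intro Limsup_eq) auto
  ultimately show ?thesis by (simp only: esssup_def)
qed

lemma esssup_cmult_ennreal:
  fixes g :: "'a \<Rightarrow> ennreal"
  assumes "0 < c"
  shows "esssup M (\<lambda>x. ennreal c * g x) = ennreal c * esssup M g"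
proof (rule antisym)
  have le: "esssup M (\<lambda>x. ennreal d * f x) \<le> ennreal d * esssup M f" if "0 < d" for d and f :: "'a \<Rightarrow> ennreal"
  proof (cases "f \<in> borel_measurable M")
    case True
    have "AE x in M. ennreal d * f x \<le> ennreal d * esssup M f"
      using esssup_AE[of f M] by eventually_elim (auto intro: mult_left_mono)
    with True show ?thesis by (intro esssup_I) auto
  next
    \<comment> \<open>The essential supremum of a non-measurable function is
      \<open>\<infinity>\<close> by convention, and \<open>d > 0\<close> keeps the product
      infinite.\<close>
    case False
    with that show ?thesis by (simp add: esssup_non_measurable ennreal_mult_top)
  qed
  show "esssup M (\<lambda>x. ennreal c * g x) \<le> ennreal c * esssup M g" using assms by (rule le)
  have "ennreal c * esssup M g = ennreal c * esssup M (\<lambda>x. ennreal (1 / c) * (ennreal c * g x))"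
    using assms by (simp add: mult.assoc[symmetric] ennreal_mult'[symmetric])
  also have "\<dots> \<le> ennreal c * (ennreal (1 / c) * esssup M (\<lambda>x. ennreal c * g x))"
    using assms by (intro mult_left_mono le) auto
  also have "\<dots> = esssup M (\<lambda>x. ennreal c * g x)"
    using assms by (simp add: mult.assoc[symmetric] ennreal_mult'[symmetric])
  finally show "ennreal c * esssup M g \<le> esssup M (\<lambda>x. ennreal c * g x)" .
qed

lemma epowr_cmult:
  assumes "0 < c"
  shows "epowr (ennreal c * t) a = ennreal (c powr a) * epowr t a"
proof (cases t)
  case (real r)
  then show ?thesis
    using assms by (simp add: epowr_def ennreal_mult'[symmetric] powr_mult)
next
  case top
  then show ?thesis using assms by (simp add: epowr_def ennreal_mult_top)
qed

lemma enn2real_ge_one: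
  assumes "1 \<le> p" "p \<noteq> \<infinity>"
  shows "1 \<le> enn2real p"
  using enn2real_mono[of 1 p] assms by (simp add: less_top)

lemma Lp_norm_cmult:
  assumes "0 < c" "1 \<le> p"
  shows "Lp_norm M p (\<lambda>y. ennreal c * g y) = ennreal c * Lp_norm M p g"
proof (cases "p = \<infinity>")
  case False
  have "0 < enn2real p" using enn2real_ge_one[OF assms(2) False] by simp
  with assms(1) False show ?thesis
    by (simp add: Lp_norm_def epowr_cmult nn_integral_cmult_pos_real powr_powr)
next
  case True
  then show ?thesis using assms by (simp add: Lp_norm_def esssup_cmult_ennreal)
qed

text \<open>Substituting the inverse turns each one-sided estimate for arbitrary functions into an
  equality.\<close>

lemma invertible_matE:
  fixes A :: "real mat"
  assumes A: "A \<in> carrier_mat n n" and d: "Determinant.det A \<noteq> 0"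
  obtains B where "B \<in> carrier_mat n n" "A * B = 1\<^sub>m n" "Determinant.det B = 1 / Determinant.det A"
proof -
  obtain B where B: "B \<in> carrier_mat n n" "A * B = 1\<^sub>m n"
    using det_non_zero_imp_unit[OF A d, of "()"] by (auto simp: Units_def ring_mat_def)
  then have "Determinant.det A * Determinant.det B = 1"
    using det_mult[OF A B(1)] by simp
  with B d that show thesis by (simp add: field_simps)
qed

lemma nn_integral_mat_apply:
  assumes A: "A \<in> carrier_mat n n" and d: "Determinant.det A \<noteq> 0"
  shows "(\<integral>\<^sup>+x. g (mat_apply A x) \<partial>lborel_fun n)
    = ennreal (1 / \<bar>Determinant.det A\<bar>) * (\<integral>\<^sup>+x. g x \<partial>lborel_fun n)"
proof (rule antisym)
  have le: "ennreal (1 / \<bar>Determinant.det B\<bar>) * (\<integral>\<^sup>+x. f x \<partial>lborel_fun n) \<le> (\<integral>\<^sup>+x. f (mat_apply B x) \<partial>lborel_fun n)"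
    if "B \<in> carrier_mat n n" "Determinant.det B \<noteq> 0" for B f
    using that by (intro nn_integral_transform_le[where \<Phi> = "\<lambda>h x. h (mat_apply B x)"])
      (auto simp: le_fun_def nn_integral_mat_apply_measurable)
  show "ennreal (1 / \<bar>Determinant.det A\<bar>) * (\<integral>\<^sup>+x. g x \<partial>lborel_fun n) \<le> (\<integral>\<^sup>+x. g (mat_apply A x) \<partial>lborel_fun n)"
    using A d by (rule le)
  obtain B where B: "B \<in> carrier_mat n n" "A * B = 1\<^sub>m n" "Determinant.det B = 1 / Determinant.det A"
    using A d by (rule invertible_matE)
  \<comment> \<open>The inequality \<open>le\<close> is now used for the inverse \<open>B\<close>
    and the function \<open>g\<close> composed with \<open>A\<close>; the two determinant factors
    cancel.\<close>
  have "(\<integral>\<^sup>+x. g (mat_apply A x) \<partial>lborel_fun n) =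
      ennreal (1 / \<bar>Determinant.det A\<bar>) * (ennreal (1 / \<bar>Determinant.det B\<bar>) * (\<integral>\<^sup>+x. g (mat_apply A x) \<partial>lborel_fun n))"
    using d by (simp add: B mult.assoc[symmetric] ennreal_mult'[symmetric])
  also have "\<dots> \<le> ennreal (1 / \<bar>Determinant.det A\<bar>) * (\<integral>\<^sup>+x. g (mat_apply A (mat_apply B x)) \<partial>lborel_fun n)"
    using B d by (intro mult_left_mono le) auto
  also have "(\<integral>\<^sup>+x. g (mat_apply A (mat_apply B x)) \<partial>lborel_fun n) = (\<integral>\<^sup>+x. g x \<partial>lborel_fun n)"
    using A B by (intro nn_integral_cong)
      (auto simp: mat_apply_mult[symmetric] mat_apply_one space_PiM PiE_def extensional_restrict)
  finally show "(\<integral>\<^sup>+x. g (mat_apply A x) \<partial>lborel_fun n)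
      \<le> ennreal (1 / \<bar>Determinant.det A\<bar>) * (\<integral>\<^sup>+x. g x \<partial>lborel_fun n)" .
qed

text \<open>The measure of the preimage is the integral of the indicator of \<open>N\<close>
  composed with \<open>A\<close>, a multiple of the measure of \<open>N\<close>.\<close>

lemma vimage_mat_apply_null_sets:
  assumes A: "A \<in> carrier_mat n n" and d: "Determinant.det A \<noteq> 0" and N: "N \<in> null_sets (lborel_fun n)"
  shows "mat_apply A -` N \<inter> space (lborel_fun n) \<in> null_sets (lborel_fun n)"
proof -
  let ?N = "mat_apply A -` N \<inter> space (lborel_fun n)"
  have S: "?N \<in> sets (lborel_fun n)"
    using measurable_sets[OF measurable_mat_apply[OF A]] N by blast
  then have "emeasure (lborel_fun n) ?N = (\<integral>\<^sup>+x. indicator ?N x \<partial>lborel_fun n)"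
    by simp
  also have "\<dots> = (\<integral>\<^sup>+x. indicator N (mat_apply A x) \<partial>lborel_fun n)"
    by (rule nn_integral_cong) (auto simp: indicator_def)
  also have "\<dots> = 0"
    using N by (simp add: nn_integral_mat_apply[OF A d] null_setsD1 null_setsD2)
  finally show ?thesis using S by auto
qed

text \<open>A set of the completion is a measurable set together with part of a null set, and
  preimages respect both.\<close>

lemma measurable_completion_mat_apply:
  assumes A: "A \<in> carrier_mat n n" and d: "Determinant.det A \<noteq> 0"
  shows "mat_apply A \<in> leb_factor n \<rightarrow>\<^sub>M leb_factor n"
  unfolding leb_factor_def
proof (rule measurableI)
  fix x assume "x \<in> space (completion (lborel_fun n))"
  then show "mat_apply A x \<in> space (completion (lborel_fun n))"
    using measurable_space[OF measurable_mat_apply[OF A]] by simp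
next
  fix S assume "S \<in> sets (completion (lborel_fun n))"
  then obtain S' N N' where S: "S = S' \<union> N" "N \<subseteq> N'" "N' \<in> null_sets (lborel_fun n)" "S' \<in> sets (lborel_fun n)"
    by (rule sets_completionE)
  let ?v = "\<lambda>X. mat_apply A -` X \<inter> space (lborel_fun n)"
  have "?v S \<in> sets (completion (lborel_fun n))"
  proof (rule sets_completionI)
    show "?v S = ?v S' \<union> ?v N" "?v N \<subseteq> ?v N'" using S by auto
    show "?v N' \<in> null_sets (lborel_fun n)" using A d S(3) by (rule vimage_mat_apply_null_sets)
    show "?v S' \<in> sets (lborel_fun n)"
      using measurable_sets[OF measurable_mat_apply[OF A]] S(4) .
  qed
  then show "mat_apply A -` S \<inter> space (completion (lborel_fun n)) \<in> sets (completion (lborel_fun n))"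
    by simp
qed

text \<open>An almost everywhere bound pulls back because preimages of null sets are null; the
  reverse inequality comes from the inverse matrix. For non-measurable functions the bound is
  \<open>\<infinity>\<close>.\<close>

lemma esssup_mat_apply:
  fixes g :: "_ \<Rightarrow> ennreal"
  assumes A: "A \<in> carrier_mat n n" and d: "Determinant.det A \<noteq> 0"
  shows "esssup (leb_factor n) (\<lambda>x. g (mat_apply A x)) = esssup (leb_factor n) g"
proof (rule antisym)
  have le: "esssup (leb_factor n) (\<lambda>x. f (mat_apply B x)) \<le> esssup (leb_factor n) f"
    if B: "B \<in> carrier_mat n n" "Determinant.det B \<noteq> 0" for B and f :: "_ \<Rightarrow> ennreal"
  proof (cases "f \<in> borel_measurable (leb_factor n)")
    case True
    have "AE x in lborel_fun n. f x \<le> esssup (leb_factor n) f"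
      using esssup_AE[of f "leb_factor n"] unfolding leb_factor_def AE_completion_iff .
    then obtain N where N: "{x \<in> space (lborel_fun n). \<not> f x \<le> esssup (leb_factor n) f} \<subseteq> N"
        "N \<in> null_sets (lborel_fun n)"
      by (auto simp: eventually_ae_filter)
    have "AE x in lborel_fun n. f (mat_apply B x) \<le> esssup (leb_factor n) f"
      using N(1) measurable_space[OF measurable_mat_apply[OF B(1)]]
      by (intro AE_I'[OF vimage_mat_apply_null_sets[OF B N(2)]]) auto
    then have "AE x in leb_factor n. f (mat_apply B x) \<le> esssup (leb_factor n) f"
      unfolding leb_factor_def AE_completion_iff .
    then show ?thesis
      by (intro esssup_I measurable_compose[OF measurable_completion_mat_apply[OF B] True])
  next
    case False
    then show ?thesis by (simp add: esssup_non_measurable)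
  qed
  show "esssup (leb_factor n) (\<lambda>x. g (mat_apply A x)) \<le> esssup (leb_factor n) g"
    using A d by (rule le)
  obtain B where B: "B \<in> carrier_mat n n" "A * B = 1\<^sub>m n" "Determinant.det B = 1 / Determinant.det A"
    using A d by (rule invertible_matE)
  have "esssup (leb_factor n) g = esssup (leb_factor n) (\<lambda>x. g (mat_apply A (mat_apply B x)))"
    using A B by (intro esssup_cong)
      (auto simp: mat_apply_mult[symmetric] mat_apply_one leb_factor_def space_PiM PiE_def extensional_restrict)
  also have "\<dots> \<le> esssup (leb_factor n) (\<lambda>x. g (mat_apply A x))"
    using B d by (intro le) auto
  finally show "esssup (leb_factor n) g \<le> esssup (leb_factor n) (\<lambda>x. g (mat_apply A x))" .
qed

text \<open>For \<open>p = \<infinity>\<close> the exponent is \<open>- 1 / enn2real \<infinity> = 0\<close>.\<close>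

lemma Lp_norm_mat_apply:
  assumes A: "A \<in> carrier_mat n n" and d: "Determinant.det A \<noteq> 0" 
  shows "Lp_norm (leb_factor n) p (\<lambda>x. g (mat_apply A x))
    = ennreal (\<bar>Determinant.det A\<bar> powr (- 1 / enn2real p)) * Lp_norm (leb_factor n) p g"
proof (cases "p = \<infinity>")
  case False
  let ?q = "enn2real p"
  have "(1 / \<bar>Determinant.det A\<bar>) powr (1 / ?q) = \<bar>Determinant.det A\<bar> powr (- 1 / ?q)"
    using d by (simp add: powr_divide powr_minus inverse_eq_divide)
  with False show ?thesis
    using d nn_integral_mat_apply[OF A d, of "\<lambda>x. epowr (g x) ?q"]
    by (simp add: Lp_norm_def leb_factor_def nn_integral_completion epowr_cmult)
next
  case True
  then show ?thesis
    unfolding Lp_norm_def using esssup_mat_apply[OF A d, of g] d by simp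
qed

section \<open>Mixed norms of dilations and boxes\<close>

text \<open>The first \<open>k\<close> coordinates of the point are overwritten by the variables of
  integration. This makes the complete mixed norm insensitive to the values of its starting point
  below \<open>l\<close>.\<close>

lemma iter_norm_cong_tail:
  assumes "\<And>j. k \<le> j \<Longrightarrow> x j = y j"
  shows "iter_norm m p F k x = iter_norm m p F k y"
  using assms
proof (induction k arbitrary: x y)
  case 0
  then have "x = y" by auto
  then show ?case by simp
next
  case (Suc k)
  have "iter_norm m p F k (x(k := z)) = iter_norm m p F k (y(k := z))" for z
    using Suc.prems by (intro Suc.IH) auto
  then show ?case by simp
qed

text \<open>The factor produced by the first \<open>k\<close> variables, both for a dilated function
  and for the box. An infinite exponent contributes \<open>1\<close>, since
  \<open>1 / enn2real \<infinity> = 0\<close>.\<close>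

definition dil_factor :: "(nat \<Rightarrow> real mat) \<Rightarrow> (nat \<Rightarrow> ennreal) \<Rightarrow> nat \<Rightarrow> real" where
  "dil_factor A p k = (\<Prod>j<k. \<bar>Determinant.det (A j)\<bar> powr (- 1 / enn2real (p j)))"

lemma dil_factor_simps [simp]:
  "dil_factor A p 0 = 1"
  "dil_factor A p (Suc k) = dil_factor A p k * \<bar>Determinant.det (A k)\<bar> powr (- 1 / enn2real (p k))"
  by (simp_all add: dil_factor_def)

lemma dil_factor_pos:
  assumes "\<And>j. j < k \<Longrightarrow> Determinant.det (A j) \<noteq> 0"
  shows "0 < dil_factor A p k"
  unfolding dil_factor_def using assms by (intro prod_pos) auto

text \<open>Induction from the innermost variable outwards: the factor gathered so far leaves the
  next norm by homogeneity, and the linear change of variables in coordinate \<open>k\<close>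
  contributes one more.\<close>

lemma iter_norm_dilation:
  assumes "\<And>j. j < l \<Longrightarrow> A j \<in> carrier_mat (m j) (m j)"
    and "\<And>j. j < l \<Longrightarrow> Determinant.det (A j) \<noteq> 0"
    and "\<And>j. j < l \<Longrightarrow> 1 \<le> p j" and "k \<le> l"
  shows "iter_norm m p (\<lambda>x. ennreal \<bar>dilation l A f x\<bar>) k x
    = ennreal (dil_factor A p k)
      * iter_norm m p (\<lambda>x. ennreal \<bar>f x\<bar>) k (\<lambda>j\<in>{..<l}. mat_apply (A j) (x j))"
  using \<open>k \<le> l\<close>
proof (induction k arbitrary: x)
  case 0
  show ?case by (simp only: iter_norm.simps dil_factor_simps dilation_def ennreal_1 mult_1)
next
  case (Suc k)
  let ?D = "\<lambda>x. \<lambda>j\<in>{..<l}. mat_apply (A j) (x j)"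
  let ?N = "iter_norm m p (\<lambda>x. ennreal \<bar>f x\<bar>)"
  have k: "k < l" using Suc.prems by simp
  have upd: "?D (x(k := y)) = (?D x)(k := mat_apply (A k) y)" for y
    using k by (auto simp: fun_eq_iff)
  have IH: "iter_norm m p (\<lambda>x. ennreal \<bar>dilation l A f x\<bar>) k (x(k := y))
      = ennreal (dil_factor A p k) * ?N k ((?D x)(k := mat_apply (A k) y))" for y
    using Suc.IH[of "x(k := y)"] k unfolding upd by (meson less_imp_le)
  have "iter_norm m p (\<lambda>x. ennreal \<bar>dilation l A f x\<bar>) (Suc k) x
      = Lp_norm (leb_factor (m k)) (p k)
          (\<lambda>y. ennreal (dil_factor A p k) * ?N k ((?D x)(k := mat_apply (A k) y)))"
    by (simp only: iter_norm.simps IH)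
  also have "\<dots> = ennreal (dil_factor A p k) * Lp_norm (leb_factor (m k)) (p k)
          (\<lambda>y. ?N k ((?D x)(k := mat_apply (A k) y)))"
    using assms k by (intro Lp_norm_cmult dil_factor_pos) auto
  also have "Lp_norm (leb_factor (m k)) (p k) (\<lambda>y. ?N k ((?D x)(k := mat_apply (A k) y)))
      = ennreal (\<bar>Determinant.det (A k)\<bar> powr (- 1 / enn2real (p k))) * ?N (Suc k) (?D x)"
    using Lp_norm_mat_apply[of "A k" "m k" "p k" "\<lambda>y. ?N k ((?D x)(k := y))"] assms k by simp
  finally show ?case
    by (simp add: mult.assoc[symmetric] ennreal_mult'' del: iter_norm.simps restrict_apply)
qed

lemma mixed_norm_dilation:
  assumes "\<And>j. j < l \<Longrightarrow> A j \<in> carrier_mat (m j) (m j)"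
    and "\<And>j. j < l \<Longrightarrow> Determinant.det (A j) \<noteq> 0"
    and "\<And>j. j < l \<Longrightarrow> 1 \<le> p j"
  shows "mixed_norm l m p (dilation l A f) = ennreal (dil_factor A p l) * mixed_norm l m p f"
proof -
  let ?N = "iter_norm m p (\<lambda>x. ennreal \<bar>f x\<bar>) l"
  have "mixed_norm l m p (dilation l A f)
      = ennreal (dil_factor A p l) * ?N (\<lambda>j\<in>{..<l}. mat_apply (A j) undefined)"
    unfolding mixed_norm_def by (rule iter_norm_dilation) (use assms in auto)
  \<comment> \<open>From index \<open>l\<close> on both starting points take the value
    \<open>undefined\<close>.\<close>
  also have "?N (\<lambda>j\<in>{..<l}. mat_apply (A j) undefined) = ?N (\<lambda>_. undefined)"
    by (rule iter_norm_cong_tail) simp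
  finally show ?thesis by (simp only: mixed_norm_def)
qed

section \<open>Norms of indicators, cubes and boxes\<close>

lemma esssup_indicator:
  assumes S: "S \<in> sets M" and pos: "emeasure M S \<noteq> 0"
  shows "esssup M (indicator S :: 'a \<Rightarrow> ennreal) = 1"
proof (rule antisym)
  show "esssup M (indicator S :: 'a \<Rightarrow> ennreal) \<le> 1"
    using S by (intro esssup_I) (auto simp: indicator_def)
  show "1 \<le> esssup M (indicator S :: 'a \<Rightarrow> ennreal)"
  proof (rule ccontr)
    assume less: "\<not> ?thesis"
    have "AE x in M. indicator S x \<le> esssup M (indicator S :: 'a \<Rightarrow> ennreal)"
      by (rule esssup_AE)
    \<comment> \<open>On \<open>S\<close> the indicator is \<open>1\<close>, so an essential
      supremum below \<open>1\<close> would make \<open>S\<close> a null set.\<close>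
    then have "AE x in M. x \<notin> S"
      using less by (auto elim!: eventually_mono simp: indicator_def)
    then have "emeasure M S = 0"
      using S by (simp add: AE_iff_null_sets[symmetric] null_setsD1)
    with pos show False ..
  qed
qed

lemma Lp_norm_indicator:
  assumes S: "S \<in> sets M" and m: "emeasure M S = ennreal c" and c: "0 < c" and p: "1 \<le> p"
  shows "Lp_norm M p (indicator S) = ennreal (c powr (1 / enn2real p))"
proof (cases "p = \<infinity>")
  case True
  then show ?thesis using S m c by (simp add: Lp_norm_def esssup_indicator)
next
  case False
  have "0 < enn2real p" using enn2real_ge_one[OF p False] by simp
  then have "(\<lambda>y. epowr (indicator S y) (enn2real p)) = indicator S"
    by (auto simp: epowr_def indicator_def fun_eq_iff)
  then show ?thesis using S m c False by (simp add: Lp_norm_def epowr_def)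
qed

lemma Lp_norm_zero: "Lp_norm M p (\<lambda>_. 0) = 0"
proof (cases "p = \<infinity>")
  case True
  have "esssup M (\<lambda>_. 0 :: ennreal) \<le> 0" by (rule esssup_I) auto
  with True show ?thesis by (simp add: Lp_norm_def)
qed (simp add: Lp_norm_def epowr_def)

lemma sets_cube: "(\<Pi>\<^sub>E i\<in>{..<n}. {0..d}) \<in> sets (lborel_fun n)"
  by (intro sets_PiM_I_finite) auto

lemma emeasure_cube:
  assumes "0 \<le> d"
  shows "emeasure (lborel_fun n) (\<Pi>\<^sub>E i\<in>{..<n}. {0..d}) = ennreal (d ^ n)"
proof -
  interpret product_sigma_finite "\<lambda>_::nat. lborel :: real measure" ..
  show ?thesis using assms by (simp add: emeasure_PiM ennreal_power)
qed

text \<open>The side length gives the cube volume \<open>1 / D\<close> in every dimension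
  \<open>n\<close>, so its norm is exactly the factor that a matrix with
  \<open>\<bar>det\<bar> = D\<close> produces under substitution.\<close>

lemma Lp_norm_cube:
  assumes "n \<ge> 1" "0 < D" "1 \<le> p"
  shows "Lp_norm (leb_factor n) p (indicator (\<Pi>\<^sub>E i\<in>{..<n}. {0..D powr (- 1 / real n)}))
    = ennreal (D powr (- 1 / enn2real p))"
proof -
  have "(D powr (- 1 / real n)) ^ n = D powr (- 1)"
    using assms by (simp add: powr_powr flip: powr_realpow)
  then have "emeasure (leb_factor n) (\<Pi>\<^sub>E i\<in>{..<n}. {0..D powr (- 1 / real n)}) = ennreal (D powr (- 1))"
    using sets_cube[of n] emeasure_cube[of _ n] by (simp add: leb_factor_def)
  then have "Lp_norm (leb_factor n) p (indicator (\<Pi>\<^sub>E i\<in>{..<n}. {0..D powr (- 1 / real n)}))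
    = ennreal ((D powr (- 1)) powr (1 / enn2real p))"
    using assms sets_cube[of n] by (intro Lp_norm_indicator) (auto simp: leb_factor_def)
  then show ?thesis using assms by (simp only: powr_powr) simp
qed

text \<open>A section of the box in variable \<open>k\<close> is either the whole cube or empty. The
  indicator on the right keeps the conditions on the variables not yet integrated, and
  extensionality because the box is a set of extensional functions.\<close>

lemma iter_norm_indicator_dil_box:
  assumes "\<And>j. j < l \<Longrightarrow> 1 \<le> m j"
    and "\<And>j. j < l \<Longrightarrow> Determinant.det (A j) \<noteq> 0"
    and "\<And>j. j < l \<Longrightarrow> 1 \<le> p j" and "k \<le> l"
  shows "iter_norm m p (indicator (dil_box l m A)) k x = ennreal (dil_factor A p k)
    * indicator {x \<in> extensional {..<l}. \<forall>j\<in>{k..<l}. x j \<in> (\<Pi>\<^sub>E i\<in>{..<m j}. {0..dil_side m A j})} x"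
  using \<open>k \<le> l\<close>
proof (induction k arbitrary: x)
  case 0
  then show ?case
    by (auto simp: dil_box_def indicator_def PiE_iff[of x])
next
  case (Suc k)
  let ?K = "\<lambda>j. \<Pi>\<^sub>E i\<in>{..<m j}. {0..dil_side m A j}"
  let ?T = "\<lambda>k. {x \<in> extensional {..<l}. \<forall>j\<in>{k..<l}. x j \<in> ?K j}"
  have k: "k < l" using Suc.prems by simp
  have T: "x(k := y) \<in> ?T k \<longleftrightarrow> x \<in> ?T (Suc k) \<and> y \<in> ?K k" for y
  proof -
    have "x(k := y) \<in> extensional {..<l} \<longleftrightarrow> x \<in> extensional {..<l}"
      using k by (auto simp: extensional_def)
    moreover have "{k..<l} = insert k {Suc k..<l}" using k by auto
    ultimately show ?thesis by auto
  qed
  have "iter_norm m p (indicator (dil_box l m A)) (Suc k) x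
      = Lp_norm (leb_factor (m k)) (p k) (\<lambda>y. ennreal (dil_factor A p k) * indicator (?T k) (x(k := y)))"
    using Suc.IH k by simp
  also have "\<dots> = ennreal (dil_factor A p k)
      * Lp_norm (leb_factor (m k)) (p k) (\<lambda>y. indicator (?T k) (x(k := y)))"
    using assms k by (intro Lp_norm_cmult dil_factor_pos) auto
  also have "Lp_norm (leb_factor (m k)) (p k) (\<lambda>y. indicator (?T k) (x(k := y)))
      = ennreal (\<bar>Determinant.det (A k)\<bar> powr (- 1 / enn2real (p k))) * indicator (?T (Suc k)) x"
  proof (cases "x \<in> ?T (Suc k)")
    case True
    then have "(\<lambda>y. indicator (?T k) (x(k := y)) :: ennreal) = indicator (?K k)"
      using T by (auto simp: indicator_def fun_eq_iff)
    with True show ?thesis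
      using Lp_norm_cube[of "m k" "\<bar>Determinant.det (A k)\<bar>" "p k"] assms k by (simp add: dil_side_def)
  next
    case False
    then have "(\<lambda>y. indicator (?T k) (x(k := y)) :: ennreal) = (\<lambda>_. 0)"
      using T by (auto simp: indicator_def fun_eq_iff)
    with False show ?thesis by (simp add: Lp_norm_zero)
  qed
  finally show ?case
    by (simp add: mult.assoc[symmetric] ennreal_mult'')
qed

lemma mixed_norm_indicator_dil_box:
  assumes "\<And>j. j < l \<Longrightarrow> 1 \<le> m j"
    and "\<And>j. j < l \<Longrightarrow> Determinant.det (A j) \<noteq> 0"
    and "\<And>j. j < l \<Longrightarrow> 1 \<le> p j"
  shows "mixed_norm l m p (indicator (dil_box l m A)) = ennreal (dil_factor A p l)"
proof -
  have "(\<lambda>x. ennreal \<bar>indicator (dil_box l m A) x\<bar>) = indicator (dil_box l m A)"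
    by (auto simp: indicator_def fun_eq_iff)
  \<comment> \<open>For \<open>k = l\<close> only extensionality remains, and the constant
    \<open>undefined\<close> satisfies it.\<close>
  then show ?thesis
    unfolding mixed_norm_def by (simp add: iter_norm_indicator_dil_box[OF assms order_refl] extensional_def)
qed

lemma measurable_indicator_dil_box:
  "(indicator (dil_box l m A) :: _ \<Rightarrow> real) \<in> borel_measurable (leb_prod l m)"
proof -
  have "dil_box l m A \<in> sets (PiM {..<l} (\<lambda>j. lborel_fun (m j)))"
    unfolding dil_box_def using sets_cube by (intro sets_PiM_I_finite) auto
  then show ?thesis
    unfolding leb_prod_def by (intro borel_measurable_indicator) auto
qed

section \<open>Exponents, weights and comparison of the suprema\<close>

lemma exp_interior_ge_one:
  assumes "p \<in> exp_interior l Q" "j < l"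
  shows "1 \<le> p j"
proof -
  have "p \<in> topspace (exp_space l)"
    using assms(1) interior_of_subset_topspace[of "exp_space l" Q] unfolding exp_interior_def by blast
  with assms(2) show ?thesis by (auto simp: exp_space_def PiE_iff)
qed

lemma Psi_const_on_interior:
  assumes "exp_interior l Q \<noteq> {}"
  shows "(\<lambda>p. if p \<in> exp_interior l Q then 1 else \<infinity>) \<in> Psi l Q"
proof -
  have "continuous_map (subtopology (exp_space l) (exp_interior l Q)) euclidean
      (\<lambda>p. if p \<in> exp_interior l Q then 1 else \<infinity> :: ennreal)"
    by (rule continuous_map_eq[where f = "\<lambda>_. 1"]) auto
  with assms show ?thesis by (auto simp: Psi_def)
qed

text \<open>Inversion in \<open>ennreal\<close> does not split over \<open>0 * \<infinity>\<close>;
  the positivity and finiteness of the weights on the interior exclude this case.\<close>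

lemma ennreal_mult_divide_mult:
  fixes a b s t :: ennreal
  assumes "0 < s" "s < \<infinity>" "0 < t" "t < \<infinity>"
  shows "(a * b) / (s * t) = (a / t) * (b / s)"
  using assms by (simp add: divide_ennreal_def ennreal_inverse_mult mult_ac)

theorem theorem5p1:
  fixes l :: nat and m :: "nat \<Rightarrow> nat" and A :: "nat \<Rightarrow> real mat"
    and Q :: "(nat \<Rightarrow> ennreal) set" and \<psi> \<zeta> \<nu> :: "(nat \<Rightarrow> ennreal) \<Rightarrow> ennreal"
    and K :: "(nat \<Rightarrow> nat \<Rightarrow> real) set"
  assumes "l \<ge> 1"
    and "\<And>j. j < l \<Longrightarrow> m j \<ge> 1"
    and "\<And>j. j < l \<Longrightarrow> A j \<in> carrier_mat (m j) (m j)"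
    and "\<And>j. j < l \<Longrightarrow> Determinant.det (A j) \<noteq> 0"
    and "Q \<subseteq> topspace (exp_space l)"
    and "exp_convex l Q"
    and "exp_interior l Q \<noteq> {}"
    and "\<psi> \<in> Psi l Q"
    and "\<zeta> \<in> Psi l Q"
    and "\<nu> = (\<lambda>p. \<psi> p * \<zeta> p)"
    and "K = dil_box l m A"
  shows
    "(\<forall>f\<in>GLS l m Q \<psi>.
        GLS_norm l m Q \<nu> (dilation l A f) \<le> fundamental l m Q \<zeta> K * GLS_norm l m Q \<psi> f)
     \<and> (\<forall>C::ennreal. (\<forall>\<psi>'\<in>Psi l Q. \<forall>f\<in>GLS l m Q \<psi>'.
               GLS_norm l m Q (\<lambda>p. \<psi>' p * \<zeta> p) (dilation l A f) \<le> C * GLS_norm l m Q \<psi>' f)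
            \<longrightarrow> fundamental l m Q \<zeta> K \<le> C)
     \<and> (\<forall>f\<in>borel_measurable (leb_prod l m).
          (\<forall>j<l. diagonal_mat (A j)) \<and> factorable l m f
          \<and> (\<forall>p\<in>exp_interior l Q. \<psi> p = mixed_norm l m p f)
          \<longrightarrow> GLS_norm l m Q \<nu> (dilation l A f) =
                fundamental l m Q \<zeta> K * GLS_norm l m Q \<psi> f)"
proof -
  let ?I = "exp_interior l Q"
  \<comment> \<open>The factor of the dilation is the mixed norm of the box, so the quotient for
    \<open>\<nu>\<close> is a product of the two quotients whose suprema occur on the right of the
    estimate.\<close>
  have quot: "mixed_norm l m p (dilation l A f) / (\<psi>' p * \<zeta> p)
      = (mixed_norm l m p (indicator K) / \<zeta> p) * (mixed_norm l m p f / \<psi>' p)"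
    if "\<psi>' \<in> Psi l Q" "p \<in> ?I" for \<psi>' p f
  proof -
    have "mixed_norm l m p (dilation l A f) = mixed_norm l m p (indicator K) * mixed_norm l m p f"
      using assms(2-4) exp_interior_ge_one[OF that(2)]
      by (simp add: \<open>K = _\<close> mixed_norm_dilation mixed_norm_indicator_dil_box)
    then show ?thesis
      using that \<open>\<zeta> \<in> Psi l Q\<close> by (simp add: Psi_def ennreal_mult_divide_mult)
  qed
  \<comment> \<open>For the natural weight the second quotient is constantly \<open>1\<close>, which
    leaves exactly the supremum that defines the fundamental function.\<close>
  have natural: "GLS_norm l m Q (\<lambda>p. \<psi>' p * \<zeta> p) (dilation l A f) = fundamental l m Q \<zeta> K"
      "GLS_norm l m Q \<psi>' f = 1"
    if "\<psi>' \<in> Psi l Q" "\<And>p. p \<in> ?I \<Longrightarrow> \<psi>' p = mixed_norm l m p f" for \<psi>' f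
  proof -
    have one: "mixed_norm l m p f / \<psi>' p = 1" if "p \<in> ?I" for p
    proof -
      have "0 < \<psi>' p" "\<psi>' p < \<infinity>" using \<open>\<psi>' \<in> Psi l Q\<close> that by (auto simp: Psi_def)
      then show ?thesis using \<open>p \<in> ?I\<close> \<open>\<And>p. p \<in> ?I \<Longrightarrow> \<psi>' p = mixed_norm l m p f\<close>
        by (metis ennreal_divide_self infinity_ennreal_def less_irrefl)
    qed
    show "GLS_norm l m Q (\<lambda>p. \<psi>' p * \<zeta> p) (dilation l A f) = fundamental l m Q \<zeta> K"
      using that(1) by (simp add: GLS_norm_def fundamental_def quot one cong: SUP_cong)
    show "GLS_norm l m Q \<psi>' f = 1"
      using \<open>?I \<noteq> {}\<close> by (simp add: GLS_norm_def one cong: SUP_cong)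
  qed
  have "GLS_norm l m Q \<nu> (dilation l A f) \<le> fundamental l m Q \<zeta> K * GLS_norm l m Q \<psi> f" for f
    unfolding GLS_norm_def[of _ _ _ \<nu>]
  proof (rule SUP_least)
    fix p assume p: "p \<in> ?I"
    have "mixed_norm l m p (indicator K) / \<zeta> p \<le> fundamental l m Q \<zeta> K"
      unfolding fundamental_def GLS_norm_def using p by (rule SUP_upper)
    moreover have "mixed_norm l m p f / \<psi> p \<le> GLS_norm l m Q \<psi> f"
      unfolding GLS_norm_def using p by (rule SUP_upper)
    ultimately show "mixed_norm l m p (dilation l A f) / \<nu> p \<le> fundamental l m Q \<zeta> K * GLS_norm l m Q \<psi> f"
      using quot[OF \<open>\<psi> \<in> Psi l Q\<close> p] by (simp add: \<open>\<nu> = _\<close> mult_mono)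
  qed
  moreover have "fundamental l m Q \<zeta> K \<le> C"
    if C: "\<forall>\<psi>'\<in>Psi l Q. \<forall>f\<in>GLS l m Q \<psi>'.
        GLS_norm l m Q (\<lambda>p. \<psi>' p * \<zeta> p) (dilation l A f) \<le> C * GLS_norm l m Q \<psi>' f" for C
  proof -
    \<comment> \<open>The test function is the indicator of the unit cube, written as the box of
      identity matrices. All its mixed norms are \<open>1\<close>, so the weight \<open>1\<close> on
      the interior is its natural function, and the assumed bound reads
      \<open>fundamental l m Q \<zeta> K \<le> C * 1\<close>.\<close>
    define \<psi>' where "\<psi>' p = (if p \<in> ?I then 1 else \<infinity> :: ennreal)" for p
    define f :: "(nat \<Rightarrow> nat \<Rightarrow> real) \<Rightarrow> real" where "f = indicator (dil_box l m (\<lambda>j. 1\<^sub>m (m j)))"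
    have \<psi>': "\<psi>' \<in> Psi l Q"
      using Psi_const_on_interior[OF \<open>?I \<noteq> {}\<close>] by (simp add: \<psi>'_def[abs_def])
    have nat: "\<psi>' p = mixed_norm l m p f" if "p \<in> ?I" for p
      using that assms(2) exp_interior_ge_one[OF that]
      by (simp add: \<psi>'_def f_def mixed_norm_indicator_dil_box dil_factor_def)
    have "f \<in> GLS l m Q \<psi>'"
      using natural(2)[OF \<psi>' nat] measurable_indicator_dil_box by (simp add: GLS_def f_def)
    with C \<psi>' have "GLS_norm l m Q (\<lambda>p. \<psi>' p * \<zeta> p) (dilation l A f) \<le> C * GLS_norm l m Q \<psi>' f"
      by blast
    then show ?thesis by (simp add: natural[OF \<psi>' nat])
  qed
  moreover have "GLS_norm l m Q \<nu> (dilation l A f) = fundamental l m Q \<zeta> K * GLS_norm l m Q \<psi> f"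
    if "\<forall>p\<in>?I. \<psi> p = mixed_norm l m p f" for f
    using natural[OF \<open>\<psi> \<in> Psi l Q\<close>, of f] that by (simp add: \<open>\<nu> = _\<close>)
  ultimately show ?thesis by blast
qed

end
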